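(* Let $a,b\in\mathbb R$, let $V(q_1,q_2)=q_1(aq_2^2+bq_1^2)$, $H=\tfrac12(p_1^2+p_2^2)+V(q_1,q_2)$ on $\mathbb R^4$ with coordinates $x=(q_1,q_2,p_1,p_2)$, and let $X=P\,dH$ be the Hamiltonian vector field of $H$ with respect to the canonical Poisson bivector $P$. Let $\tilde P$ be the bivector field (skew-symmetric $(2,0)$ tensor) with entries $$\tilde P^{12}=\tfrac43(q_2p_1-q_1p_2),\qquad \tilde P^{13}=-\tilde P^{24}=p_1^2-p_2^2-\tfrac23aq_1q_2^2+2bq_1^3,$$ $$\tilde P^{14}=2p_1p_2+\tfrac83aq_1^2q_2,\qquad \tilde P^{23}=2p_1p_2+\tfrac43aq_2^3+4bq_1^2q_2,\qquad \tilde P^{34}=4aq_1q_2p_1-(2aq_2^2+6bq_1^2)p_2 .$$ Then $\mathcal L_X\tilde P=0$. Moreover, on the open set $\{H\neq0\}$: (i) the bivector $\hat P=H^{2/3}\tilde P$ is a Poisson bivector, i.e. $[\![\hat P,\hat P]\!]=0$, and $[\![\hat P,H^{10/3}P]\!]=0$; (ii) $\hat P$ is invertible and its inverse is the symplectic form $\hat\omega=\hat P^{-1}=H^{-8/3}\tilde\omega$, where $$\begin{aligned}\tilde\omega=&\left(\tfrac{aq_2^2+3bq_1^2}{2}p_2-aq_1q_2p_1\right)dq_1\wedge dq_2+\left(\tfrac{aq_1q_2^2}{6}-\tfrac{bq_1^3}{2}-\tfrac{p_1^2-p_2^2}{4}\right)dq_1\wedge dp_1\\&-\left(\tfrac{aq_2^3}{3}+bq_1^2q_2+\tfrac{p_1p_2}{2}\right)dq_1\wedge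 dp_2-\left(\tfrac{2aq_1^2q_2}{3}+\tfrac{p_1p_2}{2}\right)dq_2\wedge dp_1\\&+\left(-\tfrac{aq_1q_2^2}{6}+\tfrac{bq_1^3}{2}+\tfrac{p_1^2-p_2^2}{4}\right)dq_2\wedge dp_2+\tfrac{q_1p_2-q_2p_1}{3}\,dp_1\wedge dp_2,\end{aligned}$$ and $\hat\omega$ is invariant: $\mathcal L_X\hat\omega=0$ (in addition to the canonical form $\omega=dp_1\wedge dq_1+dp_2\wedge dq_2$, which satisfies $\mathcal L_X\omega=0$).
   Context: Coordinates are $x=(x^1,x^2,x^3,x^4)=(q_1,q_2,p_1,p_2)$. The canonical Poisson bivector $P$ has entries $P^{13}=P^{24}=1$, $P^{31}=P^{42}=-1$ and all others zero; $X=P\,dH$ means $X^i=\sum_jP^{ij}\partial_jH$, so $X=(p_1,p_2,-\partial_{q_1}V,-\partial_{q_2}V)$. $\mathcal L_X$ is the Lie derivative of tensor fields; for a bivector, $(\mathcal L_XB)^{ij}=\sum_k\left(X^k\partial_kB^{ij}-B^{kj}\partial_kX^i-B^{ik}\partial_kX^j\right)$. $[\![\cdot,\cdot]\!]$ is the Schouten–Nijenhuis bracket of multivector fields. The inverse of a nondegenerate bivector is the 2-form whose skew matrix $(\omega_{ij})$, with $\omega=\sum_{i<j}\omega_{ij}dx^i\wedge dx^j$, is the inverse of the matrix $(P^{ij})$. Fractional powers of $H$ with denominator 3 are real, via the real cube root. *)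

theory Defs
  imports "HOL-Analysis.Analysis"
begin

text \<open>
  A bivector field \<open>B\<close> and a 2-form \<open>w\<close> are both given by their skew matrices of components,
  \<open>B x $ i $ j\<close> standing for \<open>B\<^sup>i\<^sup>j(x)\<close> and \<open>w x $ i $ j\<close> for \<open>w\<^sub>i\<^sub>j(x)\<close>.
\<close>

definition pderiv_at :: "'n::finite \<Rightarrow> (real ^ 'n \<Rightarrow> real) \<Rightarrow> real ^ 'n \<Rightarrow> real" where
  "pderiv_at k f x = deriv (\<lambda>t. f (x + t *\<^sub>R axis k 1)) 0"

primrec Ck_on :: "nat \<Rightarrow> (real ^ 'n::finite) set \<Rightarrow> (real ^ 'n \<Rightarrow> real) \<Rightarrow> bool" where
  "Ck_on 0 U f \<longleftrightarrow> continuous_on U f"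
| "Ck_on (Suc m) U f \<longleftrightarrow> f differentiable_on U \<and> (\<forall>k. Ck_on m U (pderiv_at k f))"

definition smooth_fun_on :: "(real ^ 'n::finite) set \<Rightarrow> (real ^ 'n \<Rightarrow> real) \<Rightarrow> bool" where
  "smooth_fun_on U f \<longleftrightarrow> (\<forall>m. Ck_on m U f)"

definition smooth_skew_on :: "(real ^ 'n::finite) set \<Rightarrow> (real ^ 'n \<Rightarrow> real ^ 'n ^ 'n) \<Rightarrow> bool" where
  "smooth_skew_on U B \<longleftrightarrow>
     (\<forall>i j. smooth_fun_on U (\<lambda>x. B x $ i $ j)) \<and> (\<forall>x\<in>U. \<forall>i j. B x $ j $ i = - B x $ i $ j)"

definition hamiltonian_vf ::
    "(real ^ 'n::finite \<Rightarrow> real ^ 'n ^ 'n) \<Rightarrow> (real ^ 'n \<Rightarrow> real) \<Rightarrow> real ^ 'n \<Rightarrow> real ^ 'n" where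
  "hamiltonian_vf B h x = (\<chi> i. \<Sum>j\<in>UNIV. B x $ i $ j * pderiv_at j h x)"

definition lie_bivector ::
    "(real ^ 'n::finite \<Rightarrow> real ^ 'n) \<Rightarrow> (real ^ 'n \<Rightarrow> real ^ 'n ^ 'n) \<Rightarrow> real ^ 'n \<Rightarrow> real ^ 'n ^ 'n" where
  "lie_bivector X B x = (\<chi> i j. \<Sum>k\<in>UNIV.
       X x $ k * pderiv_at k (\<lambda>y. B y $ i $ j) x
     - B x $ k $ j * pderiv_at k (\<lambda>y. X y $ i) x
     - B x $ i $ k * pderiv_at k (\<lambda>y. X y $ j) x)"

definition lie_2form ::
    "(real ^ 'n::finite \<Rightarrow> real ^ 'n) \<Rightarrow> (real ^ 'n \<Rightarrow> real ^ 'n ^ 'n) \<Rightarrow> real ^ 'n \<Rightarrow> real ^ 'n ^ 'n" where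
  "lie_2form X w x = (\<chi> i j. \<Sum>k\<in>UNIV.
       X x $ k * pderiv_at k (\<lambda>y. w y $ i $ j) x
     + w x $ k $ j * pderiv_at i (\<lambda>y. X y $ k) x
     + w x $ i $ k * pderiv_at j (\<lambda>y. X y $ k) x)"

text \<open>
  The Schouten--Nijenhuis bracket of two bivector fields, a trivector field.  The sign is the one
  for which \<open>[X\<^sub>1 \<and> X\<^sub>2, Y\<^sub>1 \<and> Y\<^sub>2]\<close> is the sum over \<open>i\<close>, \<open>j\<close> of
  \<open>(-1)\<^sup>i\<^sup>+\<^sup>j [X\<^sub>i, Y\<^sub>j] \<and> X\<^sub>i\<^sub>' \<and> Y\<^sub>j\<^sub>'\<close>, where \<open>i'\<close> and \<open>j'\<close> are the complementary indices.
\<close>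

definition schouten ::
    "(real ^ 'n::finite \<Rightarrow> real ^ 'n ^ 'n) \<Rightarrow> (real ^ 'n \<Rightarrow> real ^ 'n ^ 'n) \<Rightarrow>
     real ^ 'n \<Rightarrow> real ^ 'n ^ 'n ^ 'n" where
  "schouten A B x =
     (let S = (\<lambda>i j k. \<Sum>m\<in>UNIV.
                  B x $ m $ k * pderiv_at m (\<lambda>y. A y $ i $ j) x
                + A x $ m $ k * pderiv_at m (\<lambda>y. B y $ i $ j) x)
      in \<chi> i j k. - (S i j k + S j k i + S k i j))"

definition ext_deriv_2form ::
    "(real ^ 'n::finite \<Rightarrow> real ^ 'n ^ 'n) \<Rightarrow> real ^ 'n \<Rightarrow> real ^ 'n ^ 'n ^ 'n" where
  "ext_deriv_2form w x = (\<chi> i j k.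
       pderiv_at i (\<lambda>y. w y $ j $ k) x
     + pderiv_at j (\<lambda>y. w y $ k $ i) x
     + pderiv_at k (\<lambda>y. w y $ i $ j) x)"

definition poisson_on :: "(real ^ 'n::finite) set \<Rightarrow> (real ^ 'n \<Rightarrow> real ^ 'n ^ 'n) \<Rightarrow> bool" where
  "poisson_on U B \<longleftrightarrow> smooth_skew_on U B \<and> (\<forall>x\<in>U. schouten B B x = 0)"

definition symplectic_on :: "(real ^ 'n::finite) set \<Rightarrow> (real ^ 'n \<Rightarrow> real ^ 'n ^ 'n) \<Rightarrow> bool" where
  "symplectic_on U w \<longleftrightarrow>
     smooth_skew_on U w \<and>
     (\<forall>x\<in>U. ext_deriv_2form w x = 0) \<and>
     (\<forall>x\<in>U. \<forall>u. (\<forall>v. u \<bullet> (w x *v v) = 0) \<longrightarrow> u = 0)"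

definition wedge :: "real ^ 'n \<Rightarrow> real ^ 'n \<Rightarrow> real ^ 'n ^ 'n" where
  "wedge u v = (\<chi> i j. u $ i * v $ j - u $ j * v $ i)"

text \<open>The coordinates are \<open>x $ 1 = q\<^sub>1\<close>, \<open>x $ 2 = q\<^sub>2\<close>, \<open>x $ 3 = p\<^sub>1\<close>, \<open>x $ 4 = p\<^sub>2\<close>.\<close>

definition dq1 :: "real ^ 4" where "dq1 = axis 1 1"
definition dq2 :: "real ^ 4" where "dq2 = axis 2 1"
definition dp1 :: "real ^ 4" where "dp1 = axis 3 1"
definition dp2 :: "real ^ 4" where "dp2 = axis 4 1"

definition V :: "real \<Rightarrow> real \<Rightarrow> real \<Rightarrow> real \<Rightarrow> real" where
  "V a b q1 q2 = q1 * (a * q2\<^sup>2 + b * q1\<^sup>2)"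

definition H :: "real \<Rightarrow> real \<Rightarrow> real ^ 4 \<Rightarrow> real" where
  "H a b x = 1/2 * ((x $ 3)\<^sup>2 + (x $ 4)\<^sup>2) + V a b (x $ 1) (x $ 2)"

definition P_can :: "real ^ 4 \<Rightarrow> real ^ 4 ^ 4" where
  "P_can x = vector
     [vector [ 0,  0, 1, 0],
      vector [ 0,  0, 0, 1],
      vector [-1,  0, 0, 0],
      vector [ 0, -1, 0, 0]]"

definition omega_can :: "real ^ 4 \<Rightarrow> real ^ 4 ^ 4" where
  "omega_can x = wedge dp1 dq1 + wedge dp2 dq2"

definition X_H :: "real \<Rightarrow> real \<Rightarrow> real ^ 4 \<Rightarrow> real ^ 4" where
  "X_H a b = hamiltonian_vf P_can (H a b)"

definition P_tilde :: "real \<Rightarrow> real \<Rightarrow> real ^ 4 \<Rightarrow> real ^ 4 ^ 4" where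
  "P_tilde a b x =
     (let q1 = x $ 1; q2 = x $ 2; p1 = x $ 3; p2 = x $ 4;
          P12 = 4/3 * (q2 * p1 - q1 * p2);
          P13 = p1\<^sup>2 - p2\<^sup>2 - 2/3 * a * q1 * q2\<^sup>2 + 2 * b * q1 ^ 3;
          P14 = 2 * p1 * p2 + 8/3 * a * q1\<^sup>2 * q2;
          P23 = 2 * p1 * p2 + 4/3 * a * q2 ^ 3 + 4 * b * q1\<^sup>2 * q2;
          P24 = - P13;
          P34 = 4 * a * q1 * q2 * p1 - (2 * a * q2\<^sup>2 + 6 * b * q1\<^sup>2) * p2
      in vector
        [vector [    0,   P12,   P13, P14],
         vector [- P12,     0,   P23, P24],
         vector [- P13, - P23,     0, P34],
         vector [- P14, - P24, - P34,   0]])"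

definition omega_tilde :: "real \<Rightarrow> real \<Rightarrow> real ^ 4 \<Rightarrow> real ^ 4 ^ 4" where
  "omega_tilde a b x =
     (let q1 = x $ 1; q2 = x $ 2; p1 = x $ 3; p2 = x $ 4
      in ((a * q2\<^sup>2 + 3 * b * q1\<^sup>2) / 2 * p2 - a * q1 * q2 * p1) *\<^sub>R wedge dq1 dq2
       + (a * q1 * q2\<^sup>2 / 6 - b * q1 ^ 3 / 2 - (p1\<^sup>2 - p2\<^sup>2) / 4) *\<^sub>R wedge dq1 dp1
       - (a * q2 ^ 3 / 3 + b * q1\<^sup>2 * q2 + p1 * p2 / 2) *\<^sub>R wedge dq1 dp2
       - (2 * a * q1\<^sup>2 * q2 / 3 + p1 * p2 / 2) *\<^sub>R wedge dq2 dp1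
       + (- (a * q1 * q2\<^sup>2 / 6) + b * q1 ^ 3 / 2 + (p1\<^sup>2 - p2\<^sup>2) / 4) *\<^sub>R wedge dq2 dp2
       + ((q1 * p2 - q2 * p1) / 3) *\<^sub>R wedge dp1 dp2)"

text \<open>The real power \<open>h\<^sup>n\<^sup>/\<^sup>3\<close>, also for negative \<open>h\<close>: \<open>root 3\<close> is the odd real cube root.\<close>

definition third_pow :: "real \<Rightarrow> int \<Rightarrow> real" where
  "third_pow h n = root 3 h powi n"

definition P_hat :: "real \<Rightarrow> real \<Rightarrow> real ^ 4 \<Rightarrow> real ^ 4 ^ 4" where
  "P_hat a b x = third_pow (H a b x) 2 *\<^sub>R P_tilde a b x"

definition omega_hat :: "real \<Rightarrow> real \<Rightarrow> real ^ 4 \<Rightarrow> real ^ 4 ^ 4" where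
  "omega_hat a b x = third_pow (H a b x) (-8) *\<^sub>R omega_tilde a b x"

end

theory Submission
  imports Defs
begin

text \<open>
  Besides \<open>P_can dH = X\<close> one has \<open>P_tilde dH = 2 H X\<close>, and all trivectors that occur are multiples of \<open>P_can \<and> X\<close>:
  \<open>P_tilde \<and> X = - 2 H P_can \<and> X\<close>, \<open>[P_tilde, P_can] = - 16/3 P_can \<and> X\<close> and
  \<open>[P_tilde, P_tilde] = 16/3 H P_can \<and> X\<close>.  In the Leibniz rule for \<open>[f A, g B]\<close> with \<open>f\<close>, \<open>g\<close> powers
  of \<open>H\<close>, the exponents \<open>2/3\<close> and \<open>10/3\<close> are those for which these multiples cancel.  On the side of forms,
  \<open>P_tilde omega_tilde = H\<^sup>2\<close> and \<open>H d omega_tilde = 8/3 omega_tilde \<and> dH\<close>, and scaling by functions of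
  \<open>H\<close> preserves invariance because \<open>X H = 0\<close>.
\<close>

section \<open>Partial derivatives\<close>

text \<open>Chain rule along the line \<open>x + t *\<^sub>R axis k 1\<close>. Every partial
  derivative below is obtained from a Frechet derivative in this way.\<close>

lemma pderiv_at_eqI:
  assumes "(f has_derivative f') (at x)"
  shows "pderiv_at k f x = f' (axis k 1)"
proof -
  have lin: "linear f'"
    using assms has_derivative_linear by blast
  have "((\<lambda>t. x + t *\<^sub>R axis k (1::real)) has_derivative (\<lambda>t. t *\<^sub>R axis k 1)) (at 0)"
    by (auto intro!: derivative_eq_intros)
  then have "((\<lambda>t. f (x + t *\<^sub>R axis k 1)) has_derivative (\<lambda>t. f' (t *\<^sub>R axis k 1))) (at 0)"
    by (rule has_derivative_compose) (simp add: assms)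
  then have "((\<lambda>t. f (x + t *\<^sub>R axis k 1)) has_real_derivative f' (axis k 1)) (at 0)"
    by (simp add: has_field_derivative_def linear_cmul[OF lin] mult.commute[of _ "f' (axis k 1)"])
  then show ?thesis
    unfolding pderiv_at_def by (rule DERIV_imp_deriv)
qed

lemma pderiv_at_frechet:
  assumes "f differentiable (at x)"
  shows "pderiv_at k f x = frechet_derivative f (at x) (axis k 1)"
  using assms by (intro pderiv_at_eqI) (simp add: frechet_derivative_works)

lemma pderiv_at_const [simp]: "pderiv_at k (\<lambda>y. c) x = 0"
  by (simp add: pderiv_at_def)

lemma pderiv_at_nth [simp]: "pderiv_at k (\<lambda>y. y $ i) x = (if i = k then 1 else 0)"
proof -
  have "((\<lambda>y::real^'a. y $ i) has_derivative (\<lambda>y. y $ i)) (at x)"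
    by (intro bounded_linear_imp_has_derivative bounded_linear_vec_nth)
  then show ?thesis
    by (simp add: pderiv_at_eqI axis_def)
qed

lemma differentiable_nth [simp]: "(\<lambda>y::real^'n. y $ i) differentiable (at x)"
  by (intro bounded_linear_imp_differentiable bounded_linear_vec_nth)

text \<open>This and the following calculus rules are simp rules whose differentiability conditions
  the simplifier discharges itself, so tensors with polynomial entries are differentiated
  automatically.\<close>

lemma pderiv_at_minus [simp]:
  assumes "f differentiable (at x)"
  shows "pderiv_at k (\<lambda>y. - f y) x = - pderiv_at k f x"
  using assms unfolding pderiv_at_frechet[OF assms] frechet_derivative_works
  by (intro pderiv_at_eqI has_derivative_minus)

lemma pderiv_at_add [simp]:
  assumes "f differentiable (at x)" and "g differentiable (at x)"
  shows "pderiv_at k (\<lambda>y. f y + g y) x = pderiv_at k f x + pderiv_at k g x"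
  using assms unfolding pderiv_at_frechet[OF assms(1)] pderiv_at_frechet[OF assms(2)]
    frechet_derivative_works
  by (intro pderiv_at_eqI has_derivative_add)

lemma pderiv_at_diff [simp]:
  assumes "f differentiable (at x)" and "g differentiable (at x)"
  shows "pderiv_at k (\<lambda>y. f y - g y) x = pderiv_at k f x - pderiv_at k g x"
  using assms unfolding pderiv_at_frechet[OF assms(1)] pderiv_at_frechet[OF assms(2)]
    frechet_derivative_works
  by (intro pderiv_at_eqI has_derivative_diff)

lemma pderiv_at_mult [simp]:
  assumes "f differentiable (at x)" and "g differentiable (at x)"
  shows "pderiv_at k (\<lambda>y. f y * g y) x = f x * pderiv_at k g x + pderiv_at k f x * g x"
  using assms unfolding pderiv_at_frechet[OF assms(1)] pderiv_at_frechet[OF assms(2)]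
    frechet_derivative_works
  by (intro pderiv_at_eqI has_derivative_mult)

lemma pderiv_at_divide_const [simp]:
  assumes "f differentiable (at x)"
  shows "pderiv_at k (\<lambda>y. f y / c) x = pderiv_at k f x / c"
  using pderiv_at_mult[OF assms differentiable_const, of k "1 / c"] by simp

lemma pderiv_at_power [simp]:
  assumes "f differentiable (at x)"
  shows "pderiv_at k (\<lambda>y. f y ^ n) x = of_nat n * f x ^ (n - 1) * pderiv_at k f x"
  using assms unfolding pderiv_at_frechet[OF assms] frechet_derivative_works
  by (intro pderiv_at_eqI) (auto intro!: derivative_eq_intros)

lemma pderiv_at_compose:
  assumes "f differentiable (at x)" and "(g has_real_derivative g') (at (f x))"
  shows "pderiv_at k (\<lambda>y. g (f y)) x = g' * pderiv_at k f x"
  using assms(1) unfolding pderiv_at_frechet[OF assms(1)] frechet_derivative_works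
  by (intro pderiv_at_eqI)
    (use assms(2) in \<open>auto simp: has_field_derivative_def intro: has_derivative_compose\<close>)

section \<open>Calculus of real powers with exponents in thirds\<close>

lemma third_pow_add:
  "h \<noteq> 0 \<Longrightarrow> third_pow h (m + n) = third_pow h m * third_pow h n"
  by (simp add: third_pow_def power_int_add)

text \<open>Holds for negative \<open>h\<close> too, since 3 is odd and the real root is a true
  inverse of cubing.\<close>

lemma third_pow_mult_3: "third_pow h (3 * int n) = h ^ n"
  by (simp add: third_pow_def power_int_mult odd_real_root_pow)

text \<open>Lowering the exponent \<open>n/3\<close> by one means replacing \<open>n\<close> by
  \<open>n - 3\<close>, so the family \<open>third_pow\<close> is closed under differentiation up to
  constants.\<close>

lemma DERIV_third_pow:
  assumes "h \<noteq> 0"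
  shows "((\<lambda>h. third_pow h n) has_real_derivative real_of_int n / 3 * third_pow h (n - 3)) (at h)"
proof -
  have r: "root 3 h \<noteq> 0"
    using assms by simp
  have "((\<lambda>h. root 3 h powi n) has_real_derivative
      real_of_int n * root 3 h powi (n - 1) * inverse (3 * root 3 h ^ 2)) (at h)"
    using assms r by (auto intro!: derivative_eq_intros split: if_splits)
  \<comment> \<open>The split-off square cancels the \<open>root 3 h ^ 2\<close> in the denominator
    of the derivative of the cube root.\<close>
  moreover have "root 3 h powi (n - 1) = root 3 h powi (n - 3) * root 3 h ^ 2"
    using r power_int_add[of "root 3 h" "n - 3" 2] by simp
  ultimately show ?thesis
    using r by (simp add: third_pow_def[abs_def] field_simps)
qed

lemma differentiable_third_pow [simp]:
  assumes "f differentiable (at x)" and "f x \<noteq> 0"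
  shows "(\<lambda>y. third_pow (f y) n) differentiable (at x)"
  by (rule differentiable_compose[of "\<lambda>h. third_pow h n" f])
     (use assms DERIV_third_pow[of "f x" n] in \<open>auto simp: has_field_derivative_def intro: differentiableI\<close>)

lemma pderiv_at_third_pow [simp]:
  assumes "f differentiable (at x)" and "f x \<noteq> 0"
  shows "pderiv_at k (\<lambda>y. third_pow (f y) n) x =
    real_of_int n / 3 * third_pow (f x) (n - 3) * pderiv_at k f x"
  using pderiv_at_compose[OF assms(1) DERIV_third_pow[OF assms(2)]] .

section \<open>Smooth functions\<close>

text \<open>As \<open>U\<close> is open, the coordinate line through \<open>x\<close> stays in
  \<open>U\<close> for small \<open>t\<close>, and the derivative at 0 sees only those
  \<open>t\<close>.\<close>

lemma pderiv_at_cong: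
  assumes "open U" and "x \<in> U" and "\<And>y. y \<in> U \<Longrightarrow> f y = g y"
  shows "pderiv_at k f x = pderiv_at k g x"
proof -
  have "((\<lambda>t. x + t *\<^sub>R axis k (1::real)) \<longlongrightarrow> x + 0 *\<^sub>R axis k 1) (nhds 0)"
    by (intro tendsto_intros filterlim_ident)
  then have "\<forall>\<^sub>F t in nhds 0. x + t *\<^sub>R axis k 1 \<in> U"
    using assms(1,2) by (auto dest: topological_tendstoD)
  then have "\<forall>\<^sub>F t in nhds 0. f (x + t *\<^sub>R axis k 1) = g (x + t *\<^sub>R axis k 1)"
    by eventually_elim (rule assms(3))
  then show ?thesis
    unfolding pderiv_at_def by (rule deriv_cong_ev) simp
qed

lemma Ck_on_cong:
  assumes "open U" and "\<And>x. x \<in> U \<Longrightarrow> f x = g x"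
  shows "Ck_on m U f \<longleftrightarrow> Ck_on m U g"
  using assms(2)
proof (induction m arbitrary: f g)
  case 0
  then show ?case using continuous_on_cong[OF refl, of U f g] by simp
next
  case (Suc m)
  have "f differentiable_on U \<longleftrightarrow> g differentiable_on U"
    unfolding differentiable_on_def
    using Suc.prems differentiable_transform_within[where d = 1 and s = U]
    by (metis zero_less_one)
  moreover have "Ck_on m U (pderiv_at k f) \<longleftrightarrow> Ck_on m U (pderiv_at k g)" for k
    using Suc.prems by (intro Suc.IH pderiv_at_cong[OF assms(1)]) auto
  ultimately show ?case by simp
qed

lemma Ck_on_Suc_imp: "Ck_on (Suc m) U f \<Longrightarrow> Ck_on m U f"
  by (induction m arbitrary: f) (auto intro: differentiable_imp_continuous_on)

text \<open>The form used in the inductions: the partial derivatives may be given by formulas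
  \<open>g k\<close> that are valid on \<open>U\<close> only.\<close>

lemma Ck_on_SucI:
  assumes "open U" and "\<And>x. x \<in> U \<Longrightarrow> f differentiable (at x)"
    and "\<And>k x. x \<in> U \<Longrightarrow> pderiv_at k f x = g k x" and "\<And>k. Ck_on m U (g k)"
  shows "Ck_on (Suc m) U f"
  using assms by (auto simp: differentiable_on_eq_differentiable_at Ck_on_cong[OF assms(1,3)])

lemma Ck_on_const: "open U \<Longrightarrow> Ck_on m U (\<lambda>y. c)"
proof (induction m arbitrary: c)
  case (Suc m)
  then show ?case by (intro Ck_on_SucI[where g = "\<lambda>_ _. 0"]) auto
qed simp

lemma Ck_on_nth: "open U \<Longrightarrow> Ck_on m U (\<lambda>y. y $ i)"
proof (cases m)
  case (Suc m')
  assume "open U"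
  then show ?thesis
    unfolding Suc by (intro Ck_on_SucI[where g = "\<lambda>k _. if i = k then 1 else 0"])
      (auto intro: Ck_on_const)
qed (auto intro: continuous_intros)

lemma Ck_on_add:
  assumes "open U"
  shows "Ck_on m U f \<Longrightarrow> Ck_on m U g \<Longrightarrow> Ck_on m U (\<lambda>y. f y + g y)"
proof (induction m arbitrary: f g)
  case (Suc m)
  show ?case
    by (rule Ck_on_SucI[where g = "\<lambda>k y. pderiv_at k f y + pderiv_at k g y"])
      (use assms Suc in \<open>auto simp: differentiable_on_eq_differentiable_at\<close>)
qed (auto intro: continuous_intros)

lemma Ck_on_mult:
  assumes "open U"
  shows "Ck_on m U f \<Longrightarrow> Ck_on m U g \<Longrightarrow> Ck_on m U (\<lambda>y. f y * g y)"
proof (induction m arbitrary: f g)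
  case (Suc m)
  \<comment> \<open>The Leibniz formula contains the undifferentiated factors, which the induction
    hypothesis needs at order \<open>m\<close>.\<close>
  have "Ck_on m U f" "Ck_on m U g"
    using Suc.prems Ck_on_Suc_imp by blast+
  then show ?case
    by (intro Ck_on_SucI[where g = "\<lambda>k y. f y * pderiv_at k g y + pderiv_at k f y * g y"])
      (use assms Suc in \<open>auto simp: differentiable_on_eq_differentiable_at intro!: Ck_on_add\<close>)
qed (auto intro: continuous_intros)

lemma Ck_on_third_pow:
  assumes "open U" and "\<And>x. x \<in> U \<Longrightarrow> f x \<noteq> 0"
  shows "Ck_on m U f \<Longrightarrow> Ck_on m U (\<lambda>y. third_pow (f y) n)"
\<comment> \<open>The exponent must vary because each derivative shifts it by 3.\<close>
proof (induction m arbitrary: n)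
  case 0
  then show ?case
    using assms by (auto simp: third_pow_def intro!: continuous_intros)
next
  case (Suc m)
  have "Ck_on m U (\<lambda>y. third_pow (f y) (n - 3))"
    using Suc Ck_on_Suc_imp by blast
  then show ?case
    using assms Suc.prems
    by (intro Ck_on_SucI[where g = "\<lambda>k y. real_of_int n / 3 * third_pow (f y) (n - 3) * pderiv_at k f y"])
      (auto simp: differentiable_on_eq_differentiable_at simp del: times_divide_eq_left
        intro!: Ck_on_mult Ck_on_const)
qed

lemma smooth_fun_on_const: "open U \<Longrightarrow> smooth_fun_on U (\<lambda>y. c)"
  by (simp add: smooth_fun_on_def Ck_on_const)

lemma smooth_fun_on_nth: "open U \<Longrightarrow> smooth_fun_on U (\<lambda>y. y $ i)"
  by (simp add: smooth_fun_on_def Ck_on_nth)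

lemma smooth_fun_on_add:
  "open U \<Longrightarrow> smooth_fun_on U f \<Longrightarrow> smooth_fun_on U g \<Longrightarrow> smooth_fun_on U (\<lambda>y. f y + g y)"
  by (simp add: smooth_fun_on_def Ck_on_add)

lemma smooth_fun_on_mult:
  "open U \<Longrightarrow> smooth_fun_on U f \<Longrightarrow> smooth_fun_on U g \<Longrightarrow> smooth_fun_on U (\<lambda>y. f y * g y)"
  by (simp add: smooth_fun_on_def Ck_on_mult)

lemma smooth_fun_on_divide_const:
  "open U \<Longrightarrow> smooth_fun_on U f \<Longrightarrow> smooth_fun_on U (\<lambda>y. f y / c)"
  using smooth_fun_on_mult[OF _ _ smooth_fun_on_const[of U "1 / c"]] by simp

lemma smooth_fun_on_minus:
  "open U \<Longrightarrow> smooth_fun_on U f \<Longrightarrow> smooth_fun_on U (\<lambda>y. - f y)"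
  using smooth_fun_on_mult[OF _ smooth_fun_on_const[of U "-1"]] by simp

lemma smooth_fun_on_diff:
  "open U \<Longrightarrow> smooth_fun_on U f \<Longrightarrow> smooth_fun_on U g \<Longrightarrow> smooth_fun_on U (\<lambda>y. f y - g y)"
  using smooth_fun_on_add[OF _ _ smooth_fun_on_minus[of U g]] by simp

lemma smooth_fun_on_power:
  "open U \<Longrightarrow> smooth_fun_on U f \<Longrightarrow> smooth_fun_on U (\<lambda>y. f y ^ n)"
  by (induction n) (auto intro: smooth_fun_on_const smooth_fun_on_mult)

lemma smooth_fun_on_third_pow:
  "open U \<Longrightarrow> (\<And>x. x \<in> U \<Longrightarrow> f x \<noteq> 0) \<Longrightarrow> smooth_fun_on U f \<Longrightarrow>
    smooth_fun_on U (\<lambda>y. third_pow (f y) n)"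
  by (simp add: smooth_fun_on_def Ck_on_third_pow)

lemmas smooth_fun_on_intros =
  smooth_fun_on_const smooth_fun_on_nth smooth_fun_on_add smooth_fun_on_mult
  smooth_fun_on_divide_const smooth_fun_on_minus smooth_fun_on_diff smooth_fun_on_power

section \<open>Scaling by powers of a function\<close>

text \<open>Product rule with the lower power \<open>n - 3\<close> factored out of both terms, at
  the price of a factor \<open>h x\<close> on the first; no quotient by \<open>h x\<close>
  appears.\<close>

lemma pderiv_at_third_pow_scale:
  assumes "h differentiable (at x)" and "g differentiable (at x)" and "h x \<noteq> 0"
  shows "pderiv_at k (\<lambda>y. third_pow (h y) n * g y) x =
    third_pow (h x) (n - 3) * (h x * pderiv_at k g x + real_of_int n / 3 * g x * pderiv_at k h x)"
proof -
  have "third_pow (h x) n = third_pow (h x) (n - 3) * h x"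
    using third_pow_add[OF assms(3), of "n - 3" 3] third_pow_mult_3[of "h x" 1] by simp
  then show ?thesis
    using assms by (simp add: algebra_simps)
qed

text \<open>The wedge of a bivector and a vector field, or equally of a 2-form and a 1-form.\<close>

definition wedge_2_1 ::
    "(real ^ 'n::finite \<Rightarrow> real ^ 'n ^ 'n) \<Rightarrow> (real ^ 'n \<Rightarrow> real ^ 'n) \<Rightarrow>
     real ^ 'n \<Rightarrow> real ^ 'n ^ 'n ^ 'n" where
  "wedge_2_1 A Y x =
     (\<chi> i j k. A x $ i $ j * Y x $ k + A x $ j $ k * Y x $ i + A x $ k $ i * Y x $ j)"

text \<open>Leibniz rule: differentiating the scalar factor of one bivector and contracting with the
  other gives the Hamiltonian field of \<open>h\<close>, and the cyclic sum turns the product into a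
  wedge.\<close>

lemma schouten_third_pow_scale:
  fixes A B :: "real ^ 'n::finite \<Rightarrow> real ^ 'n ^ 'n"
  assumes h: "h differentiable (at x)" "h x \<noteq> 0"
    and A: "\<And>i j. (\<lambda>y. A y $ i $ j) differentiable (at x)" "\<And>i j. A x $ j $ i = - A x $ i $ j"
    and B: "\<And>i j. (\<lambda>y. B y $ i $ j) differentiable (at x)" "\<And>i j. B x $ j $ i = - B x $ i $ j"
  shows "schouten (\<lambda>y. third_pow (h y) n *\<^sub>R A y) (\<lambda>y. third_pow (h y) m *\<^sub>R B y) x =
    third_pow (h x) (n + m - 3) *\<^sub>R
      (h x *\<^sub>R schouten A B x
       + (real_of_int n / 3) *\<^sub>R wedge_2_1 A (hamiltonian_vf B h) x
       + (real_of_int m / 3) *\<^sub>R wedge_2_1 B (hamiltonian_vf A h) x)"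
proof -
  define c where "c = third_pow (h x) (n + m - 3)"
  have c: "third_pow (h x) m * third_pow (h x) (n - 3) = c"
    "third_pow (h x) n * third_pow (h x) (m - 3) = c"
    unfolding c_def third_pow_add[OF h(2), symmetric] by (simp_all add: algebra_simps)
  \<comment> \<open>\<open>schouten\<close> contracts the first index, \<open>hamiltonian_vf\<close>
    the second. The resulting sign cancels the one in the definition of
    \<open>schouten\<close>.\<close>
  have flip: "(\<Sum>l\<in>UNIV. C x $ l $ k * pderiv_at l h x) = - hamiltonian_vf C h x $ k"
    if "\<And>i j. C x $ j $ i = - C x $ i $ j" for C :: "real ^ 'n \<Rightarrow> real ^ 'n ^ 'n" and k
    unfolding hamiltonian_vf_def using that[of k]
    by (simp add: sum_negf[symmetric] del: sum_negf)
  have S: "(\<Sum>l\<in>UNIV.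
         (third_pow (h x) m *\<^sub>R B x) $ l $ k * pderiv_at l (\<lambda>y. (third_pow (h y) n *\<^sub>R A y) $ i $ j) x
       + (third_pow (h x) n *\<^sub>R A x) $ l $ k * pderiv_at l (\<lambda>y. (third_pow (h y) m *\<^sub>R B y) $ i $ j) x)
    = c * (h x * (\<Sum>l\<in>UNIV. B x $ l $ k * pderiv_at l (\<lambda>y. A y $ i $ j) x
                          + A x $ l $ k * pderiv_at l (\<lambda>y. B y $ i $ j) x)
       - real_of_int n / 3 * (A x $ i $ j * hamiltonian_vf B h x $ k)
       - real_of_int m / 3 * (B x $ i $ j * hamiltonian_vf A h x $ k))" (is "?L = ?R") for i j k
  proof -
    have "?L = (\<Sum>l\<in>UNIV.
        (third_pow (h x) m * third_pow (h x) (n - 3)) *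
          (h x * (B x $ l $ k * pderiv_at l (\<lambda>y. A y $ i $ j) x)
           + real_of_int n / 3 * A x $ i $ j * (B x $ l $ k * pderiv_at l h x))
      + (third_pow (h x) n * third_pow (h x) (m - 3)) *
          (h x * (A x $ l $ k * pderiv_at l (\<lambda>y. B y $ i $ j) x)
           + real_of_int m / 3 * B x $ i $ j * (A x $ l $ k * pderiv_at l h x)))"
      by (intro sum.cong)
        (simp_all add: pderiv_at_third_pow_scale[OF h(1) A(1) h(2)]
          pderiv_at_third_pow_scale[OF h(1) B(1) h(2)] algebra_simps)
    also have "\<dots> = ?R"
      unfolding c sum.distrib sum_distrib_left[symmetric] flip[of A, OF A(2)] flip[of B, OF B(2)]
      by (simp add: algebra_simps)
    finally show ?thesis .
  qed
  show ?thesis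
    unfolding schouten_def Let_def S c_def[symmetric]
    by (simp add: vec_eq_iff wedge_2_1_def algebra_simps)
qed

lemma ext_deriv_2form_third_pow_scale:
  assumes h: "h differentiable (at x)" "h x \<noteq> 0"
    and w: "\<And>i j. (\<lambda>y. w y $ i $ j) differentiable (at x)"
  shows "ext_deriv_2form (\<lambda>y. third_pow (h y) n *\<^sub>R w y) x =
    third_pow (h x) (n - 3) *\<^sub>R
      (h x *\<^sub>R ext_deriv_2form w x
       + (real_of_int n / 3) *\<^sub>R wedge_2_1 w (\<lambda>y. \<chi> k. pderiv_at k h y) x)"
  unfolding ext_deriv_2form_def
  by (simp add: vec_eq_iff wedge_2_1_def pderiv_at_third_pow_scale[OF h(1) w h(2)]
      algebra_simps)

text \<open>The additional Leibniz term is a multiple of the derivative of \<open>h\<close> along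
  \<open>X\<close>, which \<open>Xh\<close> makes zero.\<close>

lemma lie_2form_third_pow_scale:
  assumes h: "h differentiable (at x)" "h x \<noteq> 0"
    and w: "\<And>i j. (\<lambda>y. w y $ i $ j) differentiable (at x)"
    and Xh: "(\<Sum>k\<in>UNIV. X x $ k * pderiv_at k h x) = 0"
  shows "lie_2form X (\<lambda>y. third_pow (h y) n *\<^sub>R w y) x = third_pow (h x) n *\<^sub>R lie_2form X w x"
proof -
  have "lie_2form X (\<lambda>y. third_pow (h y) n *\<^sub>R w y) x $ i $ j =
    (\<Sum>k\<in>UNIV. third_pow (h x) n *
       (X x $ k * pderiv_at k (\<lambda>y. w y $ i $ j) x
        + w x $ k $ j * pderiv_at i (\<lambda>y. X y $ k) x
        + w x $ i $ k * pderiv_at j (\<lambda>y. X y $ k) x)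
     + real_of_int n / 3 * third_pow (h x) (n - 3) * w x $ i $ j * (X x $ k * pderiv_at k h x))" for i j
    unfolding lie_2form_def using h w by (auto intro!: sum.cong simp: algebra_simps)
  then show ?thesis
    \<comment> \<open>Fixing the shape of the first summand splits off only the term with
      \<open>Xh\<close>; the sum forming the Lie derivative of \<open>w\<close> stays whole.\<close>
    unfolding sum.distrib[of "\<lambda>k. third_pow (h x) n * _ k"] sum_distrib_left[symmetric] Xh
    by (simp add: vec_eq_iff lie_2form_def)
qed

section \<open>Polynomial identities\<close>

lemma vector_4 [simp]:
  "(vector [w, x, y, z] :: 'a::zero ^ 4) $ 1 = w"
  "(vector [w, x, y, z] :: 'a::zero ^ 4) $ 2 = x"
  "(vector [w, x, y, z] :: 'a::zero ^ 4) $ 3 = y"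
  "(vector [w, x, y, z] :: 'a::zero ^ 4) $ 4 = z"
  unfolding vector_def by simp_all

lemma H_differentiable [simp]: "H a b differentiable (at x)"
  unfolding H_def[abs_def] V_def by simp

lemma pderiv_at_H:
  "pderiv_at 1 (H a b) x = a * (x $ 2)\<^sup>2 + 3 * b * (x $ 1)\<^sup>2"
  "pderiv_at 2 (H a b) x = 2 * a * x $ 1 * x $ 2"
  "pderiv_at 3 (H a b) x = x $ 3"
  "pderiv_at 4 (H a b) x = x $ 4"
  unfolding H_def[abs_def] V_def by (simp_all add: algebra_simps power2_eq_square)

lemma X_H_eq:
  "X_H a b x = vector [x $ 3, x $ 4, - (a * (x $ 2)\<^sup>2 + 3 * b * (x $ 1)\<^sup>2), - (2 * a * x $ 1 * x $ 2)]"
  by (simp add: vec_eq_iff forall_4 X_H_def hamiltonian_vf_def P_can_def sum_4 pderiv_at_H)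

text \<open>Conservation of energy, the hypothesis \<open>Xh\<close> of
  \<open>lie_2form_third_pow_scale\<close>.\<close>

lemma X_H_H: "(\<Sum>k\<in>UNIV. X_H a b x $ k * pderiv_at k (H a b) x) = 0"
  by (simp add: sum_4 X_H_eq pderiv_at_H algebra_simps)

lemma wedge_components:
  "wedge dq1 dq2 = vector [vector [0, 1, 0, 0], vector [-1, 0, 0, 0], 0, 0]"
  "wedge dq1 dp1 = vector [vector [0, 0, 1, 0], 0, vector [-1, 0, 0, 0], 0]"
  "wedge dq1 dp2 = vector [vector [0, 0, 0, 1], 0, 0, vector [-1, 0, 0, 0]]"
  "wedge dq2 dp1 = vector [0, vector [0, 0, 1, 0], vector [0, -1, 0, 0], 0]"
  "wedge dq2 dp2 = vector [0, vector [0, 0, 0, 1], 0, vector [0, -1, 0, 0]]"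
  "wedge dp1 dp2 = vector [0, 0, vector [0, 0, 0, 1], vector [0, 0, -1, 0]]"
  "wedge dp1 dq1 = vector [vector [0, 0, -1, 0], 0, vector [1, 0, 0, 0], 0]"
  "wedge dp2 dq2 = vector [0, vector [0, 0, 0, -1], 0, vector [0, 1, 0, 0]]"
  by (simp_all add: vec_eq_iff forall_4 wedge_def dq1_def dq2_def dp1_def dp2_def axis_def)

lemma P_tilde_skew: "P_tilde a b x $ j $ i = - P_tilde a b x $ i $ j"
  using exhaust_4[of i] exhaust_4[of j] by (elim disjE) (simp_all add: P_tilde_def Let_def)

lemma P_tilde_differentiable: "(\<lambda>y. P_tilde a b y $ i $ j) differentiable (at x)"
  using exhaust_4[of i] exhaust_4[of j] by (elim disjE) (simp_all add: P_tilde_def Let_def)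

lemma omega_tilde_skew: "omega_tilde a b x $ j $ i = - omega_tilde a b x $ i $ j"
  using exhaust_4[of i] exhaust_4[of j]
  by (elim disjE) (simp_all add: omega_tilde_def wedge_components Let_def)

lemma omega_tilde_differentiable: "(\<lambda>y. omega_tilde a b y $ i $ j) differentiable (at x)"
  using exhaust_4[of i] exhaust_4[of j]
  by (elim disjE) (simp_all add: omega_tilde_def wedge_components Let_def)

lemma P_can_differentiable: "(\<lambda>y. P_can y $ i $ j) differentiable (at x)"
  by (simp add: P_can_def)

lemma P_can_skew: "P_can x $ j $ i = - P_can x $ i $ j"
  using exhaust_4[of i] exhaust_4[of j] by (elim disjE) (simp_all add: P_can_def)

section \<open>Identities relating \<open>P_tilde\<close>, \<open>omega_tilde\<close>,
  \<open>P_can\<close> and \<open>X_H\<close>\<close>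

lemma hamiltonian_vf_P_tilde: "hamiltonian_vf (P_tilde a b) (H a b) x = (2 * H a b x) *\<^sub>R X_H a b x"
  by (simp add: vec_eq_iff forall_4 hamiltonian_vf_def P_tilde_def Let_def sum_4 pderiv_at_H X_H_eq)
     \<comment> \<open>\<open>H\<close> stays folded until \<open>pderiv_at_H\<close> has been
       applied; only now is it expanded, leaving polynomial identities.\<close>
     (simp add: H_def V_def field_simps power2_eq_square power3_eq_cube)

lemma wedge_P_tilde_X_H:
  "wedge_2_1 (P_tilde a b) (X_H a b) x =
    - (2 * H a b x) *\<^sub>R wedge_2_1 P_can (X_H a b) x"
  by (simp add: vec_eq_iff forall_4 wedge_2_1_def P_tilde_def P_can_def Let_def X_H_eq)
     (simp add: H_def V_def field_simps power2_eq_square power3_eq_cube)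

lemma schouten_P_tilde_P_can:
  "schouten (P_tilde a b) P_can x = - (16 / 3) *\<^sub>R wedge_2_1 P_can (X_H a b) x"
  by (simp add: vec_eq_iff forall_4 schouten_def wedge_2_1_def P_tilde_def P_can_def Let_def sum_4 X_H_eq)
     (simp add: field_simps power2_eq_square power3_eq_cube)

lemma lie_2form_omega_can: "lie_2form (X_H a b) omega_can x = 0"
  by (simp add: vec_eq_iff forall_4 lie_2form_def omega_can_def wedge_components sum_4 X_H_eq)

lemma lie_bivector_P_tilde: "lie_bivector (X_H a b) (P_tilde a b) x = 0"
  by (simp add: vec_eq_iff forall_4 lie_bivector_def P_tilde_def Let_def sum_4 X_H_eq)
     (simp add: field_simps power2_eq_square power3_eq_cube)

lemma lie_2form_omega_tilde: "lie_2form (X_H a b) (omega_tilde a b) x = 0"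
  by (simp add: vec_eq_iff forall_4 lie_2form_def omega_tilde_def wedge_components Let_def sum_4 X_H_eq)
     (simp add: field_simps power2_eq_square power3_eq_cube)

text \<open>\<open>omega_tilde\<close> is, up to the factor -1/4, the Pfaffian adjoint of
  \<open>P_tilde\<close> (its 12 entry is \<open>- P34 / 4\<close>, its 13 entry
  \<open>P24 / 4\<close>), and the Pfaffian of \<open>P_tilde\<close> is
  \<open>4 * H\<^sup>2\<close>.\<close>

lemma P_tilde_mult_omega_tilde: 
  "P_tilde a b x ** omega_tilde a b x = (H a b x)\<^sup>2 *\<^sub>R mat 1"
  by (simp add: vec_eq_iff forall_4 matrix_matrix_mult_def mat_def P_tilde_def
      omega_tilde_def wedge_components Let_def sum_4)
     (simp add: H_def V_def field_simps power2_eq_square power3_eq_cube)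

text \<open>The coefficient 8/3 is what the factor \<open>third_pow (H a b x) (-8)\<close> cancels,
  which makes \<open>omega_hat\<close> closed.\<close>

lemma ext_deriv_omega_tilde: 
  "H a b x *\<^sub>R ext_deriv_2form (omega_tilde a b) x =
   (8/3) *\<^sub>R wedge_2_1 (omega_tilde a b) (\<lambda>y. \<chi> k. pderiv_at k (H a b) y) x"
  by (simp add: vec_eq_iff forall_4 ext_deriv_2form_def wedge_2_1_def omega_tilde_def wedge_components
      Let_def pderiv_at_H)
     (simp add: H_def V_def field_simps power2_eq_square power3_eq_cube)

text \<open>A trivector in dimension four has four independent components. This reduces the 64
  entries of the quadratic expression \<open>schouten (P_tilde a b) (P_tilde a b) x\<close> to
  four.\<close>

lemma alternating_4_eqI:
  fixes T U :: "real ^ 4 ^ 4 ^ 4"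
  assumes T: "\<And>i j k. T $ i $ j $ k = T $ j $ k $ i" "\<And>i j k. T $ j $ i $ k = - T $ i $ j $ k"
    and U: "\<And>i j k. U $ i $ j $ k = U $ j $ k $ i" "\<And>i j k. U $ j $ i $ k = - U $ i $ j $ k"
    and "T $ 1 $ 2 $ 3 = U $ 1 $ 2 $ 3" "T $ 1 $ 2 $ 4 = U $ 1 $ 2 $ 4"
      "T $ 1 $ 3 $ 4 = U $ 1 $ 3 $ 4" "T $ 2 $ 3 $ 4 = U $ 2 $ 3 $ 4"
  shows "T = U"
proof -
  define D where "D = T - U"
  have cyc: "D $ i $ j $ k = D $ j $ k $ i" and skew: "D $ j $ i $ k = - D $ i $ j $ k" for i j k
    using T(1)[of i j k] U(1)[of i j k] T(2)[of j i k] U(2)[of j i k] by (simp_all add: D_def)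
  have base: "D $ 1 $ 2 $ 3 = 0" "D $ 1 $ 2 $ 4 = 0" "D $ 1 $ 3 $ 4 = 0" "D $ 2 $ 3 $ 4 = 0"
    using assms(5-) by (simp_all add: D_def)
  have eq0: "D $ i $ i $ k = 0" "D $ i $ k $ i = 0" "D $ k $ i $ i = 0" for i k
    using skew[of i i k] cyc[of i k i] cyc[of k i i] by simp_all
  have perm: "D $ j $ k $ i = 0" "D $ k $ i $ j = 0" "D $ j $ i $ k = 0" "D $ i $ k $ j = 0"
    "D $ k $ j $ i = 0" if "D $ i $ j $ k = 0" for i j k
    using that cyc[of i j k] cyc[of j k i] skew[of i j k] cyc[of j i k] cyc[of i k j] by simp_all
  have "D = 0"
    by (simp add: vec_eq_iff forall_4 eq0 base perm[OF base(1)] perm[OF base(2)]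
        perm[OF base(3)] perm[OF base(4)])
  then show ?thesis by (simp add: D_def)
qed

lemma schouten_cyclic: "schouten A B x $ i $ j $ k = schouten A B x $ j $ k $ i"
  by (simp add: schouten_def Let_def)

lemma schouten_skew:
  assumes A: "\<And>i j. (\<lambda>y. A y $ i $ j) differentiable (at x)" "\<And>y i j. A y $ j $ i = - A y $ i $ j"
    and B: "\<And>i j. (\<lambda>y. B y $ i $ j) differentiable (at x)" "\<And>y i j. B y $ j $ i = - B y $ i $ j"
  shows "schouten A B x $ j $ i $ k = - schouten A B x $ i $ j $ k"
proof -
  have d: "pderiv_at m (\<lambda>y. A y $ j $ i) x = - pderiv_at m (\<lambda>y. A y $ i $ j) x"
    "pderiv_at m (\<lambda>y. B y $ j $ i) x = - pderiv_at m (\<lambda>y. B y $ i $ j) x" for m i j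
    by (simp_all only: A(2)[of _ j i] B(2)[of _ j i] pderiv_at_minus A(1) B(1))
  define S where "S i j k = (\<Sum>m\<in>UNIV.
                  B x $ m $ k * pderiv_at m (\<lambda>y. A y $ i $ j) x
                + A x $ m $ k * pderiv_at m (\<lambda>y. B y $ i $ j) x)" for i j k
  have "S j i k = - S i j k" for i j k
    unfolding S_def sum_negf[symmetric] d[of _ j i] by simp
  \<comment> \<open>Swapping \<open>i\<close> and \<open>j\<close> permutes the three terms of the
    cyclic sum up to sign; these instances are the matching pairs.\<close>
  from this[of i j k] this[of i k j] this[of k j i] show ?thesis
    unfolding schouten_def Let_def S_def[symmetric] by simp
qed

lemma wedge_2_1_cyclic:
  "wedge_2_1 A Y x $ i $ j $ k = wedge_2_1 A Y x $ j $ k $ i"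
  by (simp add: wedge_2_1_def)

lemma wedge_2_1_skew:
  assumes "\<And>i j. A x $ j $ i = - A x $ i $ j"
  shows "wedge_2_1 A Y x $ j $ i $ k = - wedge_2_1 A Y x $ i $ j $ k"
  using assms[of i j] assms[of i k] assms[of j k] by (simp add: wedge_2_1_def)

lemma schouten_P_tilde_P_tilde:
  "schouten (P_tilde a b) (P_tilde a b) x = (16 / 3 * H a b x) *\<^sub>R wedge_2_1 P_can (X_H a b) x"
proof (rule alternating_4_eqI)
  show "schouten (P_tilde a b) (P_tilde a b) x $ j $ i $ k =
      - schouten (P_tilde a b) (P_tilde a b) x $ i $ j $ k" for i j k
    by (intro schouten_skew P_tilde_differentiable P_tilde_skew)
  show "schouten (P_tilde a b) (P_tilde a b) x $ i $ j $ k =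
      schouten (P_tilde a b) (P_tilde a b) x $ j $ k $ i" for i j k
    by (rule schouten_cyclic)
  show "((16 / 3 * H a b x) *\<^sub>R wedge_2_1 P_can (X_H a b) x) $ i $ j $ k =
      ((16 / 3 * H a b x) *\<^sub>R wedge_2_1 P_can (X_H a b) x) $ j $ k $ i" for i j k
    using wedge_2_1_cyclic[of P_can "X_H a b" x i j k] by simp
  show "((16 / 3 * H a b x) *\<^sub>R wedge_2_1 P_can (X_H a b) x) $ j $ i $ k =
      - ((16 / 3 * H a b x) *\<^sub>R wedge_2_1 P_can (X_H a b) x) $ i $ j $ k" for i j k
    using wedge_2_1_skew[of P_can x "X_H a b" i j k, OF P_can_skew] by simp
\<comment> \<open>The remaining goals are the components 123, 124, 134 and 234.\<close>
qed (simp add: schouten_def wedge_2_1_def P_tilde_def P_can_def Let_def sum_4 X_H_eq,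
     simp add: H_def V_def field_simps power2_eq_square power3_eq_cube)+

section \<open>The rescaled structures\<close>

text \<open>\<open>matrix_inv\<close> is a choice of a two-sided inverse, so the left inverse law is
  derived first; for square matrices it follows from the right one.\<close>

lemma matrix_inv_eqI:
  fixes A B :: "real ^ 'n ^ 'n"
  assumes "A ** B = mat 1"
  shows "invertible A" and "matrix_inv A = B"
proof -
  have BA: "B ** A = mat 1"
    using assms by (simp add: matrix_left_right_inverse)
  with assms show inv: "invertible A"
    unfolding invertible_def by blast
  have "matrix_inv A ** A = mat 1"
    unfolding matrix_inv_def using someI[of "\<lambda>C. A ** C = mat 1 \<and> C ** A = mat 1" B] assms BA
    by blast
  then have "matrix_inv A ** (A ** B) = B"
    by (simp add: matrix_mul_assoc)
  then show "matrix_inv A = B"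
    using assms by simp
qed

lemma P_hat_mult_omega_hat:
  assumes "H a b x \<noteq> 0"
  shows "P_hat a b x ** omega_hat a b x = mat 1"
proof -
  have "third_pow (H a b x) 2 * third_pow (H a b x) (-8) * (H a b x)\<^sup>2 = 1"
    \<comment> \<open>In thirds, 2 - 8 = -6, and \<open>H\<^sup>2\<close> is the power with
      \<open>n = 6\<close>.\<close>
    using third_pow_add[OF assms, of 2 "-8"] third_pow_add[OF assms, of "-6" 6]
      third_pow_mult_3[of "H a b x" 2] third_pow_mult_3[of "H a b x" 0] by simp
  moreover have "(c *\<^sub>R A) ** (d *\<^sub>R B) = (c * d) *\<^sub>R (A ** B)" for c d and A B :: "real ^ 4 ^ 4"
    by (simp add: vec_eq_iff matrix_matrix_mult_def sum_distrib_left mult_ac)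
  ultimately show ?thesis
    by (simp add: P_hat_def omega_hat_def P_tilde_mult_omega_tilde)
qed

lemma nondegenerate_if_right_inverse:
  fixes A :: "real ^ 'n ^ 'n"
  assumes "A ** B = mat 1" and "\<And>v. u \<bullet> (A *v v) = 0"
  shows "u = 0"
proof -
  \<comment> \<open>The test vector \<open>B *v u\<close> turns the pairing into the squared norm of
    \<open>u\<close>.\<close>
  have "u \<bullet> (A *v (B *v u)) = 0"
    by (rule assms(2))
  then show ?thesis
    by (simp add: matrix_vector_mul_assoc assms(1))
qed

section \<open>Smoothness on the open set where \<open>H\<close> is nonzero\<close>

lemma smooth_fun_on_H: "open U \<Longrightarrow> smooth_fun_on U (H a b)"
  unfolding H_def[abs_def] V_def by (intro smooth_fun_on_intros)

lemma smooth_fun_on_P_tilde: "open U \<Longrightarrow> smooth_fun_on U (\<lambda>y. P_tilde a b y $ i $ j)"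
  using exhaust_4[of i] exhaust_4[of j]
  by (elim disjE) (simp_all add: P_tilde_def Let_def smooth_fun_on_intros)

lemma smooth_fun_on_omega_tilde: "open U \<Longrightarrow> smooth_fun_on U (\<lambda>y. omega_tilde a b y $ i $ j)"
  using exhaust_4[of i] exhaust_4[of j]
  by (elim disjE) (simp_all add: omega_tilde_def wedge_components Let_def smooth_fun_on_intros)

lemma open_H_ne_0: "open {x. H a b x \<noteq> 0}"
proof -
  have "continuous_on UNIV (H a b)"
    by (simp add: continuous_on_eq_continuous_at differentiable_imp_continuous_within)
  then show ?thesis
    by (intro open_Collect_neq continuous_on_const)
qed

lemma smooth_skew_on_third_pow_H_scale:
  assumes "\<And>i j. smooth_fun_on {x. H a b x \<noteq> 0} (\<lambda>y. A y $ i $ j)"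
    and "\<And>x i j. A x $ j $ i = - A x $ i $ j"
  shows "smooth_skew_on {x. H a b x \<noteq> 0} (\<lambda>y. third_pow (H a b y) n *\<^sub>R A y)"
  unfolding smooth_skew_on_def
proof (intro conjI ballI allI)
  show "smooth_fun_on {x. H a b x \<noteq> 0} (\<lambda>y. (third_pow (H a b y) n *\<^sub>R A y) $ i $ j)" for i j
    using assms(1)
    by (auto intro!: smooth_fun_on_mult smooth_fun_on_third_pow smooth_fun_on_H open_H_ne_0)
  show "(third_pow (H a b x) n *\<^sub>R A x) $ j $ i = - (third_pow (H a b x) n *\<^sub>R A x) $ i $ j" for x i j
    using assms(2)[of x i j] by simp
qed

text \<open>In units of \<open>H\<^sup>2\<close> times \<open>P_can\<close> wedge
  \<open>X_H\<close>, the bracket contributes 16/3 and each of the two Leibniz terms (2/3) * 2 *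
  (-2) = -8/3.\<close>

lemma schouten_P_hat_P_hat:
  assumes "H a b x \<noteq> 0"
  shows "schouten (P_hat a b) (P_hat a b) x = 0"
proof -
  have w: "wedge_2_1 (P_tilde a b) (hamiltonian_vf (P_tilde a b) (H a b)) x =
    (2 * H a b x) *\<^sub>R wedge_2_1 (P_tilde a b) (X_H a b) x"
    by (simp add: vec_eq_iff wedge_2_1_def hamiltonian_vf_P_tilde algebra_simps)
  show ?thesis
    unfolding P_hat_def[abs_def]
    by (subst schouten_third_pow_scale)
      \<comment> \<open>Read from right to left, skewness is a terminating rewrite rule.\<close>
      (simp_all add: assms P_tilde_differentiable P_tilde_skew[symmetric] w
        schouten_P_tilde_P_tilde wedge_P_tilde_X_H, simp add: vec_eq_iff algebra_simps)
qed

text \<open>In units of \<open>H\<close> times \<open>P_can\<close> wedge \<open>X_H\<close>, the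
  contributions are -16/3 from the bracket, (2/3) * (-2) from scaling \<open>P_tilde\<close> and
  (10/3) * 2 from scaling \<open>P_can\<close>; they add up to zero.\<close>

lemma schouten_P_hat_P_can:
  assumes "H a b x \<noteq> 0"
  shows "schouten (P_hat a b) (\<lambda>y. third_pow (H a b y) 10 *\<^sub>R P_can y) x = 0"
proof -
  have w: "wedge_2_1 P_can (hamiltonian_vf (P_tilde a b) (H a b)) x =
    (2 * H a b x) *\<^sub>R wedge_2_1 P_can (X_H a b) x"
    by (simp add: vec_eq_iff wedge_2_1_def hamiltonian_vf_P_tilde algebra_simps)
  show ?thesis
    unfolding P_hat_def[abs_def]
    by (subst schouten_third_pow_scale)
      (simp_all add: assms P_tilde_differentiable P_tilde_skew[symmetric] P_can_skew[symmetric] w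
        P_can_differentiable schouten_P_tilde_P_can X_H_def[symmetric] wedge_P_tilde_X_H,
       simp add: vec_eq_iff algebra_simps)
qed

theorem mainTheorem1:
  fixes a b :: real
  shows "(\<forall>x. lie_bivector (X_H a b) (P_tilde a b) x = 0)
    \<and> poisson_on {x. H a b x \<noteq> 0} (P_hat a b)
    \<and> (\<forall>x. H a b x \<noteq> 0 \<longrightarrow>
         schouten (P_hat a b) (\<lambda>y. third_pow (H a b y) 10 *\<^sub>R P_can y) x = 0)
    \<and> (\<forall>x. H a b x \<noteq> 0 \<longrightarrow>
         invertible (P_hat a b x) \<and> matrix_inv (P_hat a b x) = omega_hat a b x)
    \<and> symplectic_on {x. H a b x \<noteq> 0} (omega_hat a b)
    \<and> (\<forall>x. H a b x \<noteq> 0 \<longrightarrow> lie_2form (X_H a b) (omega_hat a b) x = 0)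
    \<and> (\<forall>x. lie_2form (X_H a b) omega_can x = 0)"
proof (intro conjI allI impI)
  show "lie_bivector (X_H a b) (P_tilde a b) x = 0" for x
    by (rule lie_bivector_P_tilde)
  show "poisson_on {x. H a b x \<noteq> 0} (P_hat a b)"
    unfolding poisson_on_def
  proof (intro conjI ballI)
    show "smooth_skew_on {x. H a b x \<noteq> 0} (P_hat a b)"
      unfolding P_hat_def[abs_def]
      by (intro smooth_skew_on_third_pow_H_scale smooth_fun_on_P_tilde open_H_ne_0 P_tilde_skew)
  qed (simp add: schouten_P_hat_P_hat)
  show "lie_2form (X_H a b) omega_can x = 0" for x
    by (rule lie_2form_omega_can)
  show "symplectic_on {x. H a b x \<noteq> 0} (omega_hat a b)"
    unfolding symplectic_on_def
  proof (intro conjI ballI allI impI)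
    show "smooth_skew_on {x. H a b x \<noteq> 0} (omega_hat a b)"
      unfolding omega_hat_def[abs_def]
      by (intro smooth_skew_on_third_pow_H_scale smooth_fun_on_omega_tilde open_H_ne_0
          omega_tilde_skew)
    fix x assume x: "x \<in> {x. H a b x \<noteq> 0}"
    then show "ext_deriv_2form (omega_hat a b) x = 0"
      unfolding omega_hat_def[abs_def]
      by (simp add: ext_deriv_2form_third_pow_scale omega_tilde_differentiable
          ext_deriv_omega_tilde)
    fix u assume "\<forall>v. u \<bullet> (omega_hat a b x *v v) = 0"
    \<comment> \<open>One-sided inverses of square matrices are two-sided, so \<open>P_hat\<close>
      is also a right inverse of \<open>omega_hat\<close>, which gives nondegeneracy.\<close>
    moreover have "omega_hat a b x ** P_hat a b x = mat 1"
      using x P_hat_mult_omega_hat by (simp add: matrix_left_right_inverse)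
    ultimately show "u = 0"
      using nondegenerate_if_right_inverse by blast
  qed
  fix x assume x: "H a b x \<noteq> 0"
  then show "schouten (P_hat a b) (\<lambda>y. third_pow (H a b y) 10 *\<^sub>R P_can y) x = 0"
    by (rule schouten_P_hat_P_can)
  show "invertible (P_hat a b x)" "matrix_inv (P_hat a b x) = omega_hat a b x"
    using matrix_inv_eqI[OF P_hat_mult_omega_hat[OF x]] .
  show "lie_2form (X_H a b) (omega_hat a b) x = 0"
    unfolding omega_hat_def[abs_def]
    using x by (simp add: lie_2form_third_pow_scale omega_tilde_differentiable X_H_H
        lie_2form_omega_tilde)
qed

end
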